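(* Let $X=(X,\tau)$ be a real Hausdorff topological vector space whose algebraic dual $X^*$ separates the points of $X$. Let $X^{\#}$ be a linear subspace of $X^*$ which is total (i.e. separates the points of $X$) and closed in $X^*$ for the weak-* topology $\sigma(X^*,X)$, and equip $X^{\#}$ with the subspace topology of $\sigma(X^*,X)$ (called the weak-* topology), the duality being $(x,p)\mapsto p\cdot x:=p(x)$ for $x\in X$, $p\in X^{\#}$. Let $C\neq X$ be a nonempty proper closed convex cone in $X$ with vertex $0$, let $v\in \operatorname{Int}(C)$ be an interior point of $C$, let $$C^*:=\{p\in X^{\#} : p\cdot c\le 0 \ \text{ for all } c\in C\}$$ be the polar cone of $C$, assumed to be non-degenerate (i.e. $C^*\neq\{0\}$), and let $$\Delta:=\{p\in C^* : p\cdot v=-1\}.$$ Let $\xi:\Delta\twoheadrightarrow X$ be a correspondence (assigning to each $p\in\Delta$ a subset $\xi(p)\subseteq X$) such that: 1. $\xi$ is upper demicontinuous with respect to the weak-* topology on $\Delta$ and the topology $\tau$ on $X$; 2. for every $p\in\Delta$, $\xi(p)$ is nonempty, ($\tau$-)compact and convex; 3. (Weak Walras' Law) for every $p\in\Delta$ there exists some $z\in\xi(p)$ such that $p\cdot z\le 0$. Then there exists $p^*\in\Delta$ such that $\xi(p^* )\cap C\neq\varnothing$.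
   Context: The algebraic dual $X^*$ is the space of all linear functionals $X\to\mathbb{R}$, not necessarily continuous. The topology $\sigma(X^*,X)$ is the weakest topology on $X^*$ making all evaluation maps $\ell\mapsto \ell(x)$, $x\in X$, continuous. $X$ is not assumed to be locally convex. A convex cone with vertex $0$ is a convex set $C$ with $tc\in C$ for all $c\in C$ and all real $t\ge 0$. A correspondence $\varphi:A\twoheadrightarrow Y$ from a set $A$ to a set $Y$ is a rule assigning to each $a\in A$ a subset $\varphi(a)$ of $Y$. A correspondence $\varphi:A\twoheadrightarrow Y$ from a topological space $A$ to a topological vector space $Y$ is upper demicontinuous if the set $\{a\in A:\varphi(a)\subseteq V\}$ is open in $A$ for every open half space $V$ of $Y$. An open half space of $Y$ is a set of the form $\{y\in Y: f(y)>\alpha\}$ with $f$ a nonzero continuous linear functional on $Y$ and $\alpha\in\mathbb{R}$. *)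

theory Defs
  imports "HOL-Analysis.Analysis"
begin

(* Stated with nhds filters, as in topological_monoid_add: joint continuity of scaling. *)
class real_topological_vector_space = real_vector + topological_ab_group_add +
  assumes tendsto_scaleR_Pair: "LIM x (nhds t \<times>\<^sub>F nhds a). fst x *\<^sub>R snd x :> nhds (t *\<^sub>R a)"

definition algebraic_dual :: "('a::real_vector \<Rightarrow> real) set" where
  "algebraic_dual = {f. linear f}"

(* Generated by the preimages of open sets under the evaluation maps, hence the weakest topology
   on the algebraic dual making them continuous; its topspace is algebraic_dual (take U = UNIV). *)
definition weak_star_topology :: "('a::real_vector \<Rightarrow> real) topology" where
  "weak_star_topology =
     topology_generated_by {{f \<in> algebraic_dual. f x \<in> U} | x U. open U}"

definition separates_points :: "('a \<Rightarrow> real) set \<Rightarrow> bool" where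
  "separates_points P \<longleftrightarrow> (\<forall>x y. x \<noteq> y \<longrightarrow> (\<exists>p\<in>P. p x \<noteq> p y))"

(* Written out because the function type is not an instance of real_vector. *)
definition dual_subspace :: "('a::real_vector \<Rightarrow> real) set \<Rightarrow> bool" where
  "dual_subspace P \<longleftrightarrow>
     P \<subseteq> algebraic_dual \<and> (\<lambda>x. 0) \<in> P \<and>
     (\<forall>p\<in>P. \<forall>q\<in>P. (\<lambda>x. p x + q x) \<in> P) \<and>
     (\<forall>r. \<forall>p\<in>P. (\<lambda>x. r * p x) \<in> P)"

definition polar_cone :: "('a \<Rightarrow> real) set \<Rightarrow> 'a set \<Rightarrow> ('a \<Rightarrow> real) set" where
  "polar_cone P C = {p \<in> P. \<forall>c\<in>C. p c \<le> 0}"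

definition polar_base :: "('a \<Rightarrow> real) set \<Rightarrow> 'a set \<Rightarrow> 'a \<Rightarrow> ('a \<Rightarrow> real) set" where
  "polar_base P C v = {p \<in> polar_cone P C. p v = -1}"

definition open_half_space :: "'a::real_topological_vector_space set \<Rightarrow> bool" where
  "open_half_space V \<longleftrightarrow>
     (\<exists>f \<alpha>. linear f \<and> continuous_on UNIV f \<and> f \<noteq> (\<lambda>x. 0) \<and> V = {y. f y > (\<alpha>::real)})"

(* A correspondence from A to Y is a set-valued function; only its values on topspace A matter. *)
definition upper_demicontinuous ::
    "'b topology \<Rightarrow> ('b \<Rightarrow> 'a::real_topological_vector_space set) \<Rightarrow> bool" where
  "upper_demicontinuous A \<phi> \<longleftrightarrow>
     (\<forall>V. open_half_space V \<longrightarrow> openin A {a \<in> topspace A. \<phi> a \<subseteq> V})"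

end

theory Submission
  imports Defs
begin

text \<open>
The theorem is an infinite-dimensional Gale-Debreu-Nikaido lemma, proved by contradiction.
Write \<open>\<Delta>\<close> for the base \<^term>\<open>polar_base P C v\<close>. A total subspace of the
algebraic dual is weak-* dense, so \<open>P\<close>, being closed, is the whole algebraic dual (\<open>total_weak_star_closed_eq_dual\<close>).
So \<open>\<Delta>\<close> consists of all linear functionals that are nonpositive on \<open>C\<close> and
take the value \<open>-1\<close> at \<open>v\<close>; they are continuous because \<open>C\<close> has interior points
(\<open>continuous_if_nonpos_near\<close>), and \<open>\<Delta>\<close> is weak-* compact (\<open>compact_polar_base\<close>).

Suppose that \<open>\<xi> p\<close> misses \<open>C\<close> for every \<open>p \<in> \<Delta>\<close>. The compact convex set \<open>\<xi> p\<close> can be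
separated from \<open>C\<close> by some \<open>q \<in> \<Delta>\<close> that is positive on \<open>\<xi> p\<close>
(\<open>compact_cone_separation\<close>). By upper demicontinuity, the sets
\<open>U q = {p \<in> \<Delta>. \<xi> p \<subseteq> {y. 0 < q y}}\<close> are open in \<open>\<Delta>\<close>; they cover \<open>\<Delta>\<close>, so finitely
many of them, for \<open>e 0, \<dots>, e n\<close>, cover \<open>\<Delta>\<close>. Pulling this cover back along
\<open>x \<mapsto> \<Sum>i\<le>n. x i * e i\<close> to the standard simplex, a consequence of Brouwer's theorem
(\<open>std_simplex_open_cover\<close>) yields a combination \<open>p = \<Sum>i\<le>n. x i * e i\<close> such that
\<open>p \<in> U (e i)\<close> whenever \<open>x i > 0\<close>. Then \<open>p\<close> is positive on all of \<open>\<xi> p\<close>,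
contradicting the weak Walras law.\<close>

section \<open>Total weak-* closed subspaces of the algebraic dual\<close>

text \<open>The topology of pointwise convergence on \<^typ>\<open>'a \<Rightarrow> real\<close> is the canonical topology of that type,
so the weak-* topology can be handled by type-class topology: compactness, closed sets, and
Tychonoff's theorem.\<close>

lemma weak_star_topology_eq:
  "weak_star_topology = top_of_set (algebraic_dual :: ('a::real_vector \<Rightarrow> real) set)"
proof (rule topology_eq[THEN iffD2], intro allI iffI)
  let ?B = "{{f \<in> algebraic_dual. f x \<in> U} | (x::'a) (U::real set). open U}"
  fix T :: "('a \<Rightarrow> real) set"
  {
    assume "openin weak_star_topology T"
    moreover have "openin (top_of_set algebraic_dual) B" if "B \<in> ?B" for B
    proof -
      obtain x U where B: "B = {f \<in> algebraic_dual. f x \<in> U}" "open U" using \<open>B \<in> ?B\<close> by blast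
      have "open ((\<lambda>f::'a \<Rightarrow> real. f x) -` U)"
        by (rule open_vimage[OF B(2) continuous_on_product_coordinates])
      moreover have "B = algebraic_dual \<inter> (\<lambda>f. f x) -` U" using B(1) by blast
      ultimately show ?thesis by (auto simp: openin_open)
    qed
    ultimately show "openin (top_of_set algebraic_dual) T"
      unfolding weak_star_topology_def openin_topology_generated_by_iff
      by (metis (no_types, lifting) generate_topology_on_coarsest istopology_openin)
  }
  have topsp: "topspace weak_star_topology = (algebraic_dual :: ('a \<Rightarrow> real) set)"
    unfolding weak_star_topology_def topology_generated_by_topspace by blast
  have "continuous_map weak_star_topology euclidean (\<lambda>f::'a \<Rightarrow> real. f x)" for x
    unfolding continuous_map_def
  proof (intro conjI allI impI)
    fix U :: "real set" assume "openin euclidean U"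
    then have "{f \<in> topspace weak_star_topology. f x \<in> U} \<in> ?B"
      using topsp by auto
    then show "openin weak_star_topology {f \<in> topspace weak_star_topology. f x \<in> U}"
      unfolding weak_star_topology_def by (rule topology_generated_by_Basis)
  qed simp
  then have "continuous_map weak_star_topology (product_topology (\<lambda>_. euclidean) UNIV) (\<lambda>f::'a \<Rightarrow> real. f)"
    unfolding continuous_map_componentwise_UNIV by blast
  then have "continuous_map weak_star_topology euclidean (\<lambda>f::'a \<Rightarrow> real. f)"
    unfolding euclidean_product_topology .
  moreover assume "openin (top_of_set algebraic_dual) T"
  then obtain S where "open S" "T = algebraic_dual \<inter> S" by (auto simp: openin_open)
  moreover have "{f \<in> topspace weak_star_topology. f \<in> S} = T"
    using topsp \<open>T = algebraic_dual \<inter> S\<close> by auto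
  ultimately show "openin weak_star_topology T"
    using openin_continuous_map_preimage[of weak_star_topology euclidean "\<lambda>f. f" S] by simp
qed

context
  fixes P :: "('a::real_vector \<Rightarrow> real) set"
  assumes sub: "dual_subspace P" and total: "separates_points P"
begin

lemma dual_linear: "p \<in> P \<Longrightarrow> linear p"
  using sub by (auto simp: dual_subspace_def algebraic_dual_def)

lemma dual_add_mult: "p \<in> P \<Longrightarrow> q \<in> P \<Longrightarrow> (\<lambda>x. p x + r * q x) \<in> P"
  using sub unfolding dual_subspace_def by metis

text \<open>Induction on \<open>I\<close>: when \<open>j\<close> is new and \<open>a\<close> kills \<open>I\<close> but not \<open>j\<close>, replace \<open>x\<close> by its projection
along \<open>j\<close> to the kernel of \<open>a\<close>, separate that from \<open>I\<close>, and correct the functional by a multiple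
of \<open>a\<close> so that it also kills \<open>j\<close>.\<close>

lemma total_separates_finite_span:
  assumes "finite I" "x \<notin> span I"
  shows "\<exists>p\<in>P. p x \<noteq> 0 \<and> (\<forall>i\<in>I. p i = 0)"
  using assms
proof (induction I arbitrary: x rule: finite_induct)
  case empty
  then obtain p where p: "p \<in> P" "p x \<noteq> p 0"
    using total unfolding separates_points_def by fastforce
  then show ?case using linear_0[OF dual_linear] by fastforce
next
  case (insert j I)
  show ?case
  proof (cases "j \<in> span I")
    case True
    have "x \<notin> span I" using insert.prems span_mono[of I "insert j I"] by blast
    then obtain p where p: "p \<in> P" "p x \<noteq> 0" "\<forall>i\<in>I. p i = 0" using insert.IH by blast
    moreover have "p j = 0" using linear_eq_0_on_span[OF dual_linear[OF p(1)] _ True] p(3) by blast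
    ultimately show ?thesis by blast
  next
    case False
    then obtain a where a: "a \<in> P" "a j \<noteq> 0" "\<forall>i\<in>I. a i = 0" using insert.IH by blast
    let ?x = "x - (a x / a j) *\<^sub>R j"
    have "?x \<notin> span I"
    proof
      assume "?x \<in> span I"
      then have "?x + (a x / a j) *\<^sub>R j \<in> span (insert j I)"
        by (intro span_add span_scale span_base[of j]) (use span_mono[of I "insert j I"] in blast)+
      then show False using insert.prems by simp
    qed
    then obtain p where p: "p \<in> P" "p ?x \<noteq> 0" "\<forall>i\<in>I. p i = 0" using insert.IH by blast
    let ?r = "\<lambda>y. p y + (- (p j / a j)) * a y"
    have "?r x = p ?x"
      using dual_linear[OF p(1)] by (simp add: linear_diff linear_scale)
    moreover have "?r j = 0" using a(2) by simp
    moreover have "?r \<in> P" by (rule dual_add_mult[OF p(1) a(1)])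
    ultimately show ?thesis
      using p(2,3) a(3) by (intro bexI[of _ ?r]) auto
  qed
qed

text \<open>In other words, a total subspace is weak-* dense in the algebraic dual.\<close>

lemma total_interpolates:
  assumes "finite I" "linear f"
  shows "\<exists>p\<in>P. \<forall>i\<in>I. p i = f i"
  using assms(1)
proof (induction rule: finite_induct)
  case empty
  then show ?case using sub by (auto simp: dual_subspace_def)
next
  case (insert x I)
  then obtain p where p: "p \<in> P" "\<forall>i\<in>I. p i = f i" by blast
  show ?case
  proof (cases "x \<in> span I")
    case True
    have "p x = f x"
      by (rule linear_eq_on_span[OF dual_linear[OF p(1)] assms(2) _ True]) (use p in blast)
    then show ?thesis using p by blast
  next
    case False
    then obtain r where r: "r \<in> P" "r x \<noteq> 0" "\<forall>i\<in>I. r i = 0"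
      using total_separates_finite_span insert.hyps by blast
    then show ?thesis
      using dual_add_mult[OF p(1) r(1), of "(f x - p x) / r x"] p(2)
      by (intro bexI[of _ "\<lambda>y. p y + (f x - p x) / r x * r y"]) auto
  qed
qed

text \<open>This is why the separating functionals, which a maximality argument yields without any
further control, belong to \<open>P\<close>.\<close>

lemma total_weak_star_closed_eq_dual:
  assumes "closedin weak_star_topology P"
  shows "P = algebraic_dual"
proof (rule ccontr)
  assume ne: "P \<noteq> algebraic_dual"
  have "P \<subseteq> algebraic_dual" using sub by (simp add: dual_subspace_def)
  then obtain f where f: "f \<in> algebraic_dual" "f \<notin> P" using ne by blast
  have "openin (top_of_set algebraic_dual) (algebraic_dual - P)"
    using assms unfolding weak_star_topology_eq by (simp add: closedin_def)
  then obtain T where T: "open T" "algebraic_dual - P = algebraic_dual \<inter> T"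
    by (auto simp: openin_open)
  then have "openin (product_topology (\<lambda>_. euclidean) UNIV) T" "f \<in> T"
    using f by (auto simp: open_fun_def)
  from product_topology_open_contains_basis[OF this] obtain X where
    X: "f \<in> PiE UNIV X" "finite {i. X i \<noteq> UNIV}" "PiE UNIV X \<subseteq> T"
    by auto
  obtain p where p: "p \<in> P" "\<forall>i\<in>{i. X i \<noteq> UNIV}. p i = f i"
    using total_interpolates[OF X(2), of f] f(1) by (auto simp: algebraic_dual_def)
  have "p i \<in> X i" for i
    using X(1) p(2) by (cases "X i = UNIV") (auto simp: PiE_def)
  then have "p \<in> T" using X(3) by (auto simp: PiE_def)
  then show False using T(2) p(1) \<open>P \<subseteq> algebraic_dual\<close> by blast
qed

end

section \<open>Positive functionals and order units\<close>

text \<open>The form of the Hahn-Banach theorem used here; it is purely algebraic, \<open>v\<close> being an order unit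
of the cone \<open>E\<close>. Enlarge \<open>E\<close> to a cone \<open>M\<close> maximal among those that omit \<open>- v\<close>. By maximality
\<open>M\<close> contains \<open>x\<close> or \<open>- x\<close> for every \<open>x\<close>, so each vector makes a cut in the line spanned by \<open>v\<close>,
and the position of this cut is additive in the vector, since being above and being below
the cut are both preserved by sums.\<close>

lemma positive_functional_order_unit:
  fixes E :: "'a::real_vector set"
  assumes E: "convex E" "cone E"
    and unit: "\<And>x. \<exists>s>0. v + s *\<^sub>R x \<in> E"
    and proper: "- v \<notin> E"
  obtains q where "linear q" "\<And>x. x \<in> E \<Longrightarrow> q x \<le> 0" "q v = (-1::real)"
proof -
  define \<A> where "\<A> = {M. E \<subseteq> M \<and> convex M \<and> cone M \<and> - v \<notin> M}"
  have cone_iff: "convex M \<and> cone M \<longleftrightarrow>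
      (\<forall>x\<in>M. \<forall>y\<in>M. x + y \<in> M) \<and> (\<forall>x\<in>M. \<forall>c\<ge>0. c *\<^sub>R x \<in> M)" for M :: "'a set"
    by (rule convex_cone)
  have "\<exists>M\<in>\<A>. \<forall>X\<in>\<A>. M \<subseteq> X \<longrightarrow> X = M"
  proof (rule subset_Zorn_nonempty)
    show "\<A> \<noteq> {}" using E proper by (auto simp: \<A>_def)
    fix \<C> assume ne: "\<C> \<noteq> {}" and ch: "subset.chain \<A> \<C>"
    have sub: "\<C> \<subseteq> \<A>" and tot: "\<And>X Y. X \<in> \<C> \<Longrightarrow> Y \<in> \<C> \<Longrightarrow> X \<subseteq> Y \<or> Y \<subseteq> X"
      using ch by (auto simp: subset_chain_def)
    have mem: "(\<forall>x\<in>M. \<forall>y\<in>M. x + y \<in> M) \<and> (\<forall>x\<in>M. \<forall>c\<ge>0. c *\<^sub>R x \<in> M)" if "M \<in> \<C>" for M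
      using that sub cone_iff[of M] by (auto simp: \<A>_def)
    have "\<forall>x\<in>\<Union>\<C>. \<forall>y\<in>\<Union>\<C>. x + y \<in> \<Union>\<C>"
    proof (intro ballI)
      fix x y assume "x \<in> \<Union>\<C>" "y \<in> \<Union>\<C>"
      then obtain X Y where "x \<in> X" "X \<in> \<C>" "y \<in> Y" "Y \<in> \<C>" by blast
      then show "x + y \<in> \<Union>\<C>" using tot[of X Y] mem[of X] mem[of Y] by blast
    qed
    moreover have "\<forall>x\<in>\<Union>\<C>. \<forall>c\<ge>0. c *\<^sub>R x \<in> \<Union>\<C>" using mem by blast
    ultimately have "convex (\<Union>\<C>) \<and> cone (\<Union>\<C>)" using cone_iff by blast
    then show "\<Union>\<C> \<in> \<A>" using ne sub by (auto simp: \<A>_def)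
  qed
  then obtain M where "M \<in> \<A>" and max: "\<And>X. X \<in> \<A> \<Longrightarrow> M \<subseteq> X \<Longrightarrow> X = M" by blast
  then have EM: "E \<subseteq> M" and "convex M \<and> cone M" and nv: "- v \<notin> M" by (auto simp: \<A>_def)
  then have add: "\<And>x y. x \<in> M \<Longrightarrow> y \<in> M \<Longrightarrow> x + y \<in> M"
    and scale: "\<And>c x. x \<in> M \<Longrightarrow> 0 \<le> c \<Longrightarrow> c *\<^sub>R x \<in> M"
    using cone_iff[of M] by auto
  have v: "v \<in> M" using unit[of 0] EM by auto
  have zero: "0 \<in> M" using scale[OF v, of 0] by simp
  \<comment> \<open>Adjoining a vector outside \<open>M\<close> must produce \<open>- v\<close>.\<close>
  have step: "\<exists>e\<in>M. \<exists>a>0. - v = e + a *\<^sub>R x" if x: "x \<notin> M" for x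
  proof -
    define N where "N = {e + a *\<^sub>R x | e a. e \<in> M \<and> 0 \<le> a}"
    have NI: "e + a *\<^sub>R x \<in> N" if "e \<in> M" "0 \<le> a" for e a
      using that unfolding N_def by blast
    have NE: "\<exists>e a. y = e + a *\<^sub>R x \<and> e \<in> M \<and> 0 \<le> a" if "y \<in> N" for y
      using that unfolding N_def by blast
    have "convex N \<and> cone N"
      unfolding cone_iff
    proof (intro conjI ballI allI impI)
      fix y z assume "y \<in> N" "z \<in> N"
      then obtain e a e' a' where *: "y = e + a *\<^sub>R x" "z = e' + a' *\<^sub>R x" "e \<in> M" "e' \<in> M"
        "0 \<le> a" "0 \<le> a'" using NE by metis
      then have "y + z = (e + e') + (a + a') *\<^sub>R x" "e + e' \<in> M" "0 \<le> a + a'"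
        by (auto simp: scaleR_add_left add)
      then show "y + z \<in> N" using NI by simp
    next
      fix y and c :: real assume "y \<in> N" "0 \<le> c"
      then obtain e a where *: "y = e + a *\<^sub>R x" "e \<in> M" "0 \<le> a" using NE by metis
      then have "c *\<^sub>R y = c *\<^sub>R e + (c * a) *\<^sub>R x" "c *\<^sub>R e \<in> M" "0 \<le> c * a"
        using \<open>0 \<le> c\<close> by (auto simp: scaleR_add_right scale)
      then show "c *\<^sub>R y \<in> N" using NI by simp
    qed
    moreover have MN: "M \<subseteq> N"
    proof
      fix e assume "e \<in> M"
      then show "e \<in> N" using NI[of e 0] by simp
    qed
    moreover have "x \<in> N" using NI[of 0 1] zero by simp
    ultimately have N: "convex N" "cone N" "E \<subseteq> N" "M \<subseteq> N" "x \<in> N" using EM by auto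
    have "- v \<in> N"
    proof (rule ccontr)
      assume "- v \<notin> N"
      then have "N \<in> \<A>" using N by (simp add: \<A>_def)
      from max[OF this N(4)] show False using N(5) x by simp
    qed
    then obtain e a where "- v = e + a *\<^sub>R x" "e \<in> M" "0 \<le> a" using NE by metis
    moreover have "a \<noteq> 0" using calculation nv by auto
    ultimately show ?thesis by (metis less_eq_real_def)
  qed
  have total: "x \<in> M \<or> - x \<in> M" for x
  proof (rule ccontr)
    assume "\<not> ?thesis"
    then obtain e a e' b where e: "e \<in> M" "0 < a" "- v = e + a *\<^sub>R x"
      and e': "e' \<in> M" "0 < b" "- v = e' + b *\<^sub>R (- x)"
      using step[of x] step[of "- x"] by blast
    have "(a + b) *\<^sub>R (- v) = b *\<^sub>R (e + a *\<^sub>R x) + a *\<^sub>R (e' + b *\<^sub>R (- x))"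
      unfolding e(3)[symmetric] e'(3)[symmetric] by (simp add: scaleR_add_left)
    also have "\<dots> = b *\<^sub>R e + a *\<^sub>R e'" by (simp add: algebra_simps)
    finally have "(a + b) *\<^sub>R (- v) \<in> M" using e e' by (simp add: add scale)
    from scale[OF this, of "inverse (a + b)"] show False using nv e e' by simp
  qed
  define cut where "cut x = {s::real. x - s *\<^sub>R v \<in> M}" for x
  define \<phi> where "\<phi> x = Sup (cut x)" for x
  have cut_ne: "cut x \<noteq> {}" for x
  proof -
    obtain s where s: "s > 0" "v + s *\<^sub>R x \<in> M" using unit[of x] EM by blast
    from scale[OF s(2), of "inverse s"] s(1) have "x - (- inverse s) *\<^sub>R v \<in> M"
      by (simp add: scaleR_add_right add.commute)
    then show ?thesis unfolding cut_def by blast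
  qed
  have cut_sep: "s \<le> t" if "x - s *\<^sub>R v \<in> M" "t *\<^sub>R v - x \<in> M" for s t x
  proof (rule ccontr)
    assume "\<not> s \<le> t"
    from add[OF that] have "(s - t) *\<^sub>R (- v) \<in> M" by (simp add: algebra_simps)
    from scale[OF this, of "inverse (s - t)"] show False using nv \<open>\<not> s \<le> t\<close> by simp
  qed
  have upper: "\<phi> x \<le> t" if "t *\<^sub>R v - x \<in> M" for x t
    unfolding \<phi>_def using that cut_ne cut_sep by (intro cSup_least) (auto simp: cut_def)
  have bdd: "bdd_above (cut x)" for x
  proof -
    obtain t where "- x - t *\<^sub>R v \<in> M" using cut_ne[of "- x"] by (auto simp: cut_def)
    then have "(- t) *\<^sub>R v - x \<in> M" by (simp add: minus_diff_commute[of x])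
    then show ?thesis using cut_sep by (intro bdd_aboveI[of _ "- t"]) (auto simp: cut_def)
  qed
  have lower: "s \<le> \<phi> x" if "x - s *\<^sub>R v \<in> M" for x s
    unfolding \<phi>_def using that bdd by (intro cSup_upper) (auto simp: cut_def)
  have below: "x - s *\<^sub>R v \<in> M" if "s < \<phi> x" for x s
    using total[of "x - s *\<^sub>R v"] upper[of s x] that by auto
  have above: "t *\<^sub>R v - x \<in> M" if "\<phi> x < t" for x t
    using total[of "x - t *\<^sub>R v"] lower[of x t] that by auto
  have "\<phi> (x + y) = \<phi> x + \<phi> y" for x y
  proof (rule antisym)
    show "\<phi> (x + y) \<le> \<phi> x + \<phi> y"
    proof (rule field_le_epsilon)
      fix e :: real assume "0 < e"
      then obtain d where d: "0 < d" "e = d + d" by (metis field_sum_of_halves half_gt_zero)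
      then have "(\<phi> x + d) *\<^sub>R v - x \<in> M" "(\<phi> y + d) *\<^sub>R v - y \<in> M"
        by (auto intro!: above)
      from add[OF this] have "((\<phi> x + d) + (\<phi> y + d)) *\<^sub>R v - (x + y) \<in> M"
        by (simp only: scaleR_add_left[of "\<phi> x + d"] add_diff_add)
      from upper[OF this] d show "\<phi> (x + y) \<le> \<phi> x + \<phi> y + e" by simp
    qed
    show "\<phi> x + \<phi> y \<le> \<phi> (x + y)"
    proof (rule field_le_epsilon)
      fix e :: real assume "0 < e"
      then obtain d where d: "0 < d" "e = d + d" by (metis field_sum_of_halves half_gt_zero)
      then have "x - (\<phi> x - d) *\<^sub>R v \<in> M" "y - (\<phi> y - d) *\<^sub>R v \<in> M"
        by (auto intro!: below)
      from add[OF this] have "(x + y) - ((\<phi> x - d) + (\<phi> y - d)) *\<^sub>R v \<in> M"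
        by (simp only: scaleR_add_left[of "\<phi> x - d"] add_diff_add)
      from lower[OF this] d show "\<phi> x + \<phi> y \<le> \<phi> (x + y) + e" by simp
    qed
  qed
  note \<phi>_add = this
  have \<phi>_pos: "\<phi> (c *\<^sub>R x) = c * \<phi> x" if "0 < c" for c x
  proof -
    have le: "\<phi> (c *\<^sub>R x) \<le> c * \<phi> x" if "0 < c" for c x
    proof (rule field_le_epsilon)
      fix e :: real assume "0 < e"
      then have "(\<phi> x + e / c) *\<^sub>R v - x \<in> M" using that by (intro above) simp
      from scale[OF this, of c] have "(c * \<phi> x + e) *\<^sub>R v - c *\<^sub>R x \<in> M"
        using that by (simp add: scaleR_diff_right distrib_left)
      then show "\<phi> (c *\<^sub>R x) \<le> c * \<phi> x + e" by (rule upper)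
    qed
    have "\<phi> x \<le> inverse c * \<phi> (c *\<^sub>R x)"
      using le[of "inverse c" "c *\<^sub>R x"] that by simp
    then have "c * \<phi> x \<le> \<phi> (c *\<^sub>R x)" using that by (simp add: field_simps)
    then show ?thesis using le[OF that, of x] by simp
  qed
  have \<phi>_zero: "\<phi> 0 = 0" using \<phi>_add[of 0 0] by simp
  have \<phi>_minus: "\<phi> (- x) = - \<phi> x" for x using \<phi>_add[of x "- x"] \<phi>_zero by simp
  have \<phi>_scale: "\<phi> (c *\<^sub>R x) = c * \<phi> x" for c x
  proof -
    consider "c = 0" | "0 < c" | "0 < - c" by linarith
    then show ?thesis
    proof cases
      case 3
      then show ?thesis using \<phi>_pos[of "- c" x] \<phi>_minus[of "c *\<^sub>R x"] by simp
    qed (simp_all add: \<phi>_zero \<phi>_pos)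
  qed
  show ?thesis
  proof
    show "linear (\<lambda>x. - \<phi> x)"
      by (rule linearI) (simp_all add: \<phi>_add \<phi>_scale)
    show "- \<phi> x \<le> 0" if "x \<in> E" for x
      using lower[of x 0] that EM by auto
    have "1 \<le> \<phi> v" using lower[of v 1] zero by simp
    moreover have "\<phi> v \<le> 1" using upper[of 1 v] zero by simp
    ultimately show "- \<phi> v = - 1" by simp
  qed
qed

section \<open>Separating compact convex sets from cones in topological vector spaces\<close>

lemma tendsto_scaleR_tvs:
  fixes g :: "'b \<Rightarrow> 'a::real_topological_vector_space"
  assumes "(f \<longlongrightarrow> t) F" "(g \<longlongrightarrow> a) F"
  shows "((\<lambda>x. f x *\<^sub>R g x) \<longlongrightarrow> t *\<^sub>R a) F"
  using filterlim_compose[OF tendsto_scaleR_Pair filterlim_Pair[OF assms]] by simp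

lemma interior_point_order_unit:
  fixes C :: "'a::real_topological_vector_space set"
  assumes "v \<in> interior C"
  shows "\<exists>s>0. v + s *\<^sub>R x \<in> C"
proof -
  have "((\<lambda>s. v + s *\<^sub>R x) \<longlongrightarrow> v + 0 *\<^sub>R x) (at_right 0)"
    by (intro tendsto_add tendsto_const tendsto_scaleR_tvs tendsto_ident_at)
  then have "\<forall>\<^sub>F s in at_right 0. v + s *\<^sub>R x \<in> interior C"
    using assms by (intro topological_tendstoD) auto
  moreover have "\<forall>\<^sub>F s in at_right 0. (0::real) < s"
    by (rule eventually_at_right_less)
  ultimately have "\<forall>\<^sub>F s in at_right 0. 0 < s \<and> v + s *\<^sub>R x \<in> interior C"
    by eventually_elim simp
  then show ?thesis
    using eventually_happens interior_subset trivial_limit_at_right_real by blast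
qed

text \<open>For \<open>y\<close> near \<open>x\<close> both points \<open>v \<plusminus> k (y - x)\<close> lie in \<open>C\<close>, so \<open>k \<bar>q y - q x\<bar> \<le> - q v\<close>, with \<open>k\<close> as large
as desired.\<close>

lemma continuous_if_nonpos_near:
  fixes q :: "'a::real_topological_vector_space \<Rightarrow> real"
  assumes q: "linear q" and v: "v \<in> interior C" and nonpos: "\<And>c. c \<in> C \<Longrightarrow> q c \<le> 0"
  shows "continuous_on UNIV q"
proof -
  have "\<forall>\<^sub>F y in at x. dist (q y) (q x) < e" if "0 < e" for e x
  proof -
    define k where "k = (1 - q v) / e"
    have "q v \<le> 0" using nonpos v interior_subset by blast
    then have "0 < k" using \<open>0 < e\<close> by (simp add: k_def)
    have "\<forall>\<^sub>F y in at x. v + r *\<^sub>R (y - x) \<in> interior C" for r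
    proof (rule topological_tendstoD)
      show "((\<lambda>y. v + r *\<^sub>R (y - x)) \<longlongrightarrow> v + r *\<^sub>R (x - x)) (at x)"
        by (intro tendsto_add tendsto_const tendsto_scaleR_tvs tendsto_diff tendsto_ident_at)
    qed (use v in auto)
    from this[of k] this[of "- k"]
    show ?thesis
    proof eventually_elim
      case (elim y)
      have "q (v + k *\<^sub>R (y - x)) \<le> 0" "q (v + (- k) *\<^sub>R (y - x)) \<le> 0"
        using elim nonpos interior_subset by blast+
      then have "q v + k * (q y - q x) \<le> 0" "q v - k * (q y - q x) \<le> 0"
        using q by (simp_all add: linear_add linear_diff linear_scale)
      then have "k * \<bar>q y - q x\<bar> \<le> - q v" by (cases "q y - q x \<ge> 0") (auto simp: algebra_simps)
      also have "\<dots> < k * e" using \<open>0 < e\<close> by (simp add: k_def)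
      finally show ?case using \<open>0 < k\<close> by (simp add: dist_real_def)
    qed
  qed
  then show ?thesis
    unfolding continuous_on_def by (blast intro: tendstoI)
qed

lemma uminus_interior_notin_cone:
  fixes C :: "'a::real_topological_vector_space set"
  assumes C: "convex C" "cone C" "C \<noteq> UNIV" and v: "v \<in> interior C"
  shows "- v \<notin> C"
proof
  assume nv: "- v \<in> C"
  have "x \<in> C" for x
  proof -
    obtain s where s: "0 < s" "v + s *\<^sub>R x \<in> C" using interior_point_order_unit[OF v] by blast
    have "(v + s *\<^sub>R x) + (- v) \<in> C" using C(1,2) s(2) nv convex_cone by blast
    then have "s *\<^sub>R x \<in> C" by simp
    then have "inverse s *\<^sub>R (s *\<^sub>R x) \<in> C" by (rule mem_cone[OF C(2)]) (use s(1) in simp)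
    then show "x \<in> C" using s(1) by simp
  qed
  then show False using C(3) by blast
qed

text \<open>The sets of those \<open>k\<close> with \<open>k + t v \<in> C\<close> are closed, shrink as \<open>t\<close> decreases to \<open>0\<close>, and have
their intersection over \<open>t > 0\<close> contained in \<open>C\<close>. This turns disjointness into a gap without any convex
neighbourhoods, which need not exist as the space is not assumed to be locally convex.\<close>

lemma compact_shift_avoids_cone:
  fixes C :: "'a::real_topological_vector_space set"
  assumes C: "closed C" "convex C" "cone C" and v: "v \<in> C"
    and K: "compact K" "K \<inter> C = {}"
  obtains t where "0 < t" "\<And>k. k \<in> K \<Longrightarrow> k + t *\<^sub>R v \<notin> C"
proof -
  define V where "V n = {k. k + inverse (real (Suc n)) *\<^sub>R v \<in> - C}" for n
  have "open (V n)" for n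
  proof -
    have "open ((\<lambda>k. k + inverse (real (Suc n)) *\<^sub>R v) -` (- C))"
      using C(1) by (intro open_vimage continuous_intros) auto
    then show ?thesis by (simp add: V_def vimage_def)
  qed
  moreover have "K \<subseteq> (\<Union>n. V n)"
  proof
    fix k assume "k \<in> K"
    have "(\<lambda>n. k + inverse (real (Suc n)) *\<^sub>R v) \<longlonglongrightarrow> k + 0 *\<^sub>R v"
      by (intro tendsto_add tendsto_const tendsto_scaleR_tvs LIMSEQ_inverse_real_of_nat)
    then have "\<forall>\<^sub>F n in sequentially. k + inverse (real (Suc n)) *\<^sub>R v \<in> - C"
      using C(1) K(2) \<open>k \<in> K\<close> by (intro topological_tendstoD) auto
    then obtain n where "k + inverse (real (Suc n)) *\<^sub>R v \<in> - C"
      using eventually_happens' sequentially_bot by blast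
    then show "k \<in> (\<Union>n. V n)" unfolding V_def by blast
  qed
  ultimately obtain N where N: "finite N" "K \<subseteq> (\<Union>n\<in>N. V n)"
    using compactE_image[OF K(1), of UNIV V] by auto
  define t where "t = inverse (real (Suc (Max (insert 0 N))))"
  show ?thesis
  proof
    show "0 < t" by (simp add: t_def)
    fix k assume "k \<in> K"
    then obtain n where n: "n \<in> N" "k \<in> V n" using N(2) by blast
    have le: "t \<le> inverse (real (Suc n))"
      using n N(1) by (simp add: t_def le_imp_inverse_le)
    show "k + t *\<^sub>R v \<notin> C"
    proof
      assume "k + t *\<^sub>R v \<in> C"
      moreover have "(inverse (real (Suc n)) - t) *\<^sub>R v \<in> C"
        using C(3) v le by (auto simp: cone_def)
      ultimately have "(k + t *\<^sub>R v) + (inverse (real (Suc n)) - t) *\<^sub>R v \<in> C"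
        using C(2,3) convex_cone by blast
      then have "k + inverse (real (Suc n)) *\<^sub>R v \<in> C" by (simp add: scaleR_diff_left)
      then show False using n(2) by (simp add: V_def)
    qed
  qed
qed

text \<open>Local convexity is replaced by the interior point \<open>v\<close>: once \<open>K + t v\<close> misses \<open>C\<close>, the cone
generated by \<open>C\<close> and \<open>- (K + t v)\<close> omits \<open>- v\<close>, and a functional that is nonpositive on
it satisfies \<open>q k \<ge> - t q v = t > 0\<close> on \<open>K\<close>.\<close>

lemma compact_cone_separation:
  fixes C :: "'a::real_topological_vector_space set"
  assumes C: "closed C" "convex C" "cone C" "C \<noteq> UNIV" and v: "v \<in> interior C"
    and K: "compact K" "convex K" "K \<noteq> {}" "K \<inter> C = {}"
  obtains q where "linear q" "\<And>c. c \<in> C \<Longrightarrow> q c \<le> 0" "q v = (-1::real)" "\<And>k. k \<in> K \<Longrightarrow> 0 < q k"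
proof -
  have vC: "v \<in> C" using v interior_subset by blast
  have add: "\<And>x y. x \<in> C \<Longrightarrow> y \<in> C \<Longrightarrow> x + y \<in> C"
    and scale: "\<And>x c. x \<in> C \<Longrightarrow> 0 \<le> c \<Longrightarrow> c *\<^sub>R x \<in> C"
    using C(2,3) convex_cone[of C] by auto
  obtain t where t: "0 < t" and avoid: "\<And>k. k \<in> K \<Longrightarrow> k + t *\<^sub>R v \<notin> C"
    using compact_shift_avoids_cone[OF C(1-3) vC K(1,4)] by blast
  define E where "E = {c - s *\<^sub>R (k + t *\<^sub>R v) | c s k. c \<in> C \<and> 0 \<le> s \<and> k \<in> K}"
  have EI: "c - s *\<^sub>R (k + t *\<^sub>R v) \<in> E" if "c \<in> C" "0 \<le> s" "k \<in> K" for c s k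
    using that unfolding E_def by blast
  have EE: "\<exists>c s k. x = c - s *\<^sub>R (k + t *\<^sub>R v) \<and> c \<in> C \<and> 0 \<le> s \<and> k \<in> K" if "x \<in> E" for x
    using that unfolding E_def by blast
  have CE: "C \<subseteq> E"
  proof
    fix c assume "c \<in> C"
    moreover obtain k where "k \<in> K" using K(3) by blast
    ultimately show "c \<in> E" using EI[of c 0 k] by simp
  qed
  have E: "convex E \<and> cone E"
    unfolding convex_cone
  proof (intro conjI ballI allI impI)
    fix x y assume "x \<in> E" "y \<in> E"
    then obtain c s k c' s' k' where x: "x = c - s *\<^sub>R (k + t *\<^sub>R v)" "c \<in> C" "0 \<le> s" "k \<in> K"
      and y: "y = c' - s' *\<^sub>R (k' + t *\<^sub>R v)" "c' \<in> C" "0 \<le> s'" "k' \<in> K"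
      using EE by metis
    have "\<exists>m\<in>K. s *\<^sub>R k + s' *\<^sub>R k' = (s + s') *\<^sub>R m"
    proof (cases "s + s' = 0")
      case True
      then have "s = 0" "s' = 0" using x y by auto
      then show ?thesis using x(4) by auto
    next
      case False
      let ?m = "(s / (s + s')) *\<^sub>R k + (s' / (s + s')) *\<^sub>R k'"
      have "?m \<in> K"
        using False x(3,4) y(3,4) by (intro convexD[OF K(2)]) (simp_all flip: add_divide_distrib)
      moreover have "(s + s') *\<^sub>R ?m = s *\<^sub>R k + s' *\<^sub>R k'"
        using False by (simp add: scaleR_add_right)
      ultimately show ?thesis by metis
    qed
    then obtain m where m: "m \<in> K" "s *\<^sub>R k + s' *\<^sub>R k' = (s + s') *\<^sub>R m" by blast
    have "x + y = (c + c') - ((s *\<^sub>R k + s' *\<^sub>R k') + (s + s') *\<^sub>R (t *\<^sub>R v))"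
      unfolding x(1) y(1) by (simp add: algebra_simps)
    also have "\<dots> = (c + c') - (s + s') *\<^sub>R (m + t *\<^sub>R v)"
      unfolding m(2) by (simp only: scaleR_add_right)
    finally have "x + y = (c + c') - (s + s') *\<^sub>R (m + t *\<^sub>R v)" .
    moreover have "(c + c') - (s + s') *\<^sub>R (m + t *\<^sub>R v) \<in> E"
      using x(2,3) y(2,3) m(1) by (intro EI add) auto
    ultimately show "x + y \<in> E" by metis
  next
    fix x and r :: real assume "x \<in> E" "0 \<le> r"
    then obtain c s k where x: "x = c - s *\<^sub>R (k + t *\<^sub>R v)" "c \<in> C" "0 \<le> s" "k \<in> K"
      using EE by metis
    then have "r *\<^sub>R x = r *\<^sub>R c - (r * s) *\<^sub>R (k + t *\<^sub>R v)"
      by (simp add: scaleR_diff_right)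
    then show "r *\<^sub>R x \<in> E" using EI[of "r *\<^sub>R c" "r * s" k] scale x \<open>0 \<le> r\<close> by simp
  qed
  have unit: "\<exists>s>0. v + s *\<^sub>R x \<in> E" for x
    using interior_point_order_unit[OF v, of x] CE by blast
  have nv: "- v \<notin> E"
  proof
    assume "- v \<in> E"
    then obtain c s k where e: "- v = c - s *\<^sub>R (k + t *\<^sub>R v)" "c \<in> C" "0 \<le> s" "k \<in> K"
      using EE by metis
    show False
    proof (cases "s = 0")
      case True
      then show False using e uminus_interior_notin_cone[OF C(2-4) v] by simp
    next
      case False
      have "s *\<^sub>R (k + t *\<^sub>R v) = c + v" using e(1) by (simp add: algebra_simps)
      then have "inverse s *\<^sub>R (s *\<^sub>R (k + t *\<^sub>R v)) \<in> C"
        using scale[OF add[OF e(2) vC], of "inverse s"] e(3) by simp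
      then show False using False avoid[OF e(4)] by simp
    qed
  qed
  obtain q where q: "linear q" "\<And>x. x \<in> E \<Longrightarrow> q x \<le> 0" "q v = (-1::real)"
    using positive_functional_order_unit[OF E[THEN conjunct1] E[THEN conjunct2] unit nv] by blast
  show ?thesis
  proof
    show "linear q" "q v = -1" by fact+
    show "q c \<le> 0" if "c \<in> C" for c using q(2) CE that by blast
    fix k assume "k \<in> K"
    have "0 \<in> C" using scale[OF vC, of 0] by simp
    then have "q (0 - 1 *\<^sub>R (k + t *\<^sub>R v)) \<le> 0" using q(2) EI[of 0 1 k] \<open>k \<in> K\<close> by simp
    moreover have "q (0 - 1 *\<^sub>R (k + t *\<^sub>R v)) = t - q k"
      using q(1,3) by (simp add: linear_diff linear_add linear_scale linear_neg)
    ultimately show "0 < q k" using t by linarith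
  qed
qed

section \<open>Brouwer's fixed point theorem and open covers of the simplex\<close>

lemma tendsto_fun_iff:
  fixes f :: "'b \<Rightarrow> 'i \<Rightarrow> 'c::topological_space"
  shows "(f \<longlongrightarrow> l) F \<longleftrightarrow> (\<forall>i. ((\<lambda>x. f x i) \<longlongrightarrow> l i) F)"
  using limitin_componentwise[of "\<lambda>_. euclidean" UNIV f l F]
  by (simp add: euclidean_product_topology)

lemma compact_Pi_UNIV:
  fixes S :: "'i \<Rightarrow> 'c::topological_space set"
  assumes "\<And>i. compact (S i)"
  shows "compact {x. \<forall>i. x i \<in> S i}"
proof -
  have "compactin (product_topology (\<lambda>_. euclidean) UNIV) (PiE UNIV S)"
    using assms by (simp add: compactin_PiE)
  moreover have "PiE UNIV S = {x. \<forall>i. x i \<in> S i}"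
    by (auto simp: PiE_def)
  ultimately show ?thesis
    by (simp add: euclidean_product_topology)
qed

text \<open>All finite-dimensional cubes live in the one metric space \<^typ>\<open>nat \<Rightarrow> real\<close>, the coordinates from
\<open>n\<close> on being \<open>0\<close>. The dimension needed in the main proof is the number of sets in a finite
subcover; it is obtained inside the proof and so cannot be the cardinality of a type.\<close>

definition unit_cube :: "nat \<Rightarrow> (nat \<Rightarrow> real) set" where
  "unit_cube n = {x. \<forall>i. x i \<in> (if i < n then {0..1} else {0})}"

lemma compact_unit_cube: "compact (unit_cube n)"
  unfolding unit_cube_def by (rule compact_Pi_UNIV) auto

text \<open>Brouwer's theorem from Kuhn's combinatorial lemma. Label a point \<open>x\<close> in coordinate \<open>i\<close> by \<open>0\<close> or
\<open>1\<close> according to whether \<open>f\<close> moves that coordinate up or down. If \<open>y\<close> is a limit of cells carrying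
both labels in every coordinate, then \<open>y i\<close> is a limit of points whose \<open>i\<close>-th coordinate moves
up and also of points where it moves down, so continuity gives \<open>f y i = y i\<close>.\<close>

theorem brouwer_unit_cube:
  assumes cont: "continuous_on (unit_cube n) f"
    and maps: "f ` unit_cube n \<subseteq> unit_cube n"
  obtains x where "x \<in> unit_cube n" "f x = x"
proof -
  define G :: "nat \<Rightarrow> (nat \<Rightarrow> nat) \<Rightarrow> nat \<Rightarrow> real" where
    "G = (\<lambda>k r i. if i < n then real (r i) / real (Suc k) else 0)"
  have G_cube: "G k r \<in> unit_cube n" if "\<forall>i<n. r i \<le> Suc k" for k r
    using that by (auto simp: G_def unit_cube_def divide_le_eq_1)
  have "\<forall>x. x \<in> unit_cube n \<longrightarrow> f x \<in> unit_cube n"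
    and "\<forall>x. x \<in> unit_cube n \<longrightarrow> (\<forall>i. i < n \<longrightarrow> 0 \<le> x i \<and> x i \<le> 1)"
    using maps by (auto simp: unit_cube_def split: if_splits)
  from kuhn_labelling_lemma'[OF this]
  obtain label :: "(nat \<Rightarrow> real) \<Rightarrow> nat \<Rightarrow> nat" where
    "\<forall>x i. label x i \<le> 1"
    and "\<forall>x i. x \<in> unit_cube n \<and> i < n \<and> x i = 0 \<longrightarrow> label x i = 0"
    and "\<forall>x i. x \<in> unit_cube n \<and> i < n \<and> x i = 1 \<longrightarrow> label x i = 1"
    and "\<forall>x i. x \<in> unit_cube n \<and> i < n \<and> label x i = 0 \<longrightarrow> x i \<le> f x i"
    and "\<forall>x i. x \<in> unit_cube n \<and> i < n \<and> label x i = 1 \<longrightarrow> f x i \<le> x i"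
    by blast
  note label = this[rule_format]
  \<comment> \<open>On the grid of mesh \<open>1 / Suc k\<close> Kuhn's lemma finds a cell on whose vertices every coordinate
    takes both labels; these cells shrink, and along a subsequence they converge to a point.\<close>
  have "\<exists>q. (\<forall>i<n. q i < Suc k) \<and> (\<forall>i<n. \<exists>r s.
      (\<forall>j<n. q j \<le> r j \<and> r j \<le> q j + 1) \<and> (\<forall>j<n. q j \<le> s j \<and> s j \<le> q j + 1) \<and>
      label (G k r) i \<noteq> label (G k s) i)" for k
  proof -
    have 1: "\<forall>x. (\<forall>i<n. x i \<le> Suc k) \<longrightarrow> (\<forall>i<n. label (G k x) i = 0 \<or> label (G k x) i = 1)"
      using label(1) by (metis less_one nat_less_le)
    have 2: "\<forall>x. (\<forall>i<n. x i \<le> Suc k) \<longrightarrow> (\<forall>i<n. x i = 0 \<longrightarrow> label (G k x) i = 0)"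
      using label(2) G_cube by (simp add: G_def)
    have 3: "\<forall>x. (\<forall>i<n. x i \<le> Suc k) \<longrightarrow> (\<forall>i<n. x i = Suc k \<longrightarrow> label (G k x) i = 1)"
    proof (intro allI impI)
      fix x i assume x: "\<forall>i<n. x i \<le> Suc k" and i: "i < n" "x i = Suc k"
      have "G k x i = 1" using i by (simp add: G_def)
      then show "label (G k x) i = 1" using label(3) G_cube[OF x] i by blast
    qed
    show ?thesis
      using kuhn_lemma[of "Suc k" n "\<lambda>x. label (G k x)", OF _ 1 2 3] by (metis zero_less_Suc)
  qed
  then have "\<forall>k. \<exists>q. (\<forall>i<n. q i < Suc k) \<and> (\<forall>i<n. \<exists>r s.
      (\<forall>j<n. q j \<le> r j \<and> r j \<le> q j + 1) \<and> (\<forall>j<n. q j \<le> s j \<and> s j \<le> q j + 1) \<and>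
      label (G k r) i \<noteq> label (G k s) i)" by blast
  from choice[OF this] obtain q where Q: "\<forall>k. (\<forall>i<n. q k i < Suc k) \<and> (\<forall>i<n. \<exists>r s.
      (\<forall>j<n. q k j \<le> r j \<and> r j \<le> q k j + 1) \<and> (\<forall>j<n. q k j \<le> s j \<and> s j \<le> q k j + 1) \<and>
      label (G k r) i \<noteq> label (G k s) i)" by blast
  have q: "\<And>k i. i < n \<Longrightarrow> q k i < Suc k"
    and cell: "\<And>k i. i < n \<Longrightarrow> \<exists>r s.
      (\<forall>j<n. q k j \<le> r j \<and> r j \<le> q k j + 1) \<and> (\<forall>j<n. q k j \<le> s j \<and> s j \<le> q k j + 1) \<and>
      label (G k r) i \<noteq> label (G k s) i"
    using Q by blast+
  have "G k (q k) \<in> unit_cube n" for k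
    using q by (intro G_cube) (simp add: less_imp_le)
  then obtain y \<rho> where y: "y \<in> unit_cube n" and \<rho>: "strict_mono \<rho>"
    and lim: "((\<lambda>k. G k (q k)) \<circ> \<rho>) \<longlonglongrightarrow> y"
    using compact_imp_seq_compact[OF compact_unit_cube[of n]] unfolding seq_compact_def by metis
  have near: "(\<lambda>k. G (\<rho> k) (r (\<rho> k))) \<longlonglongrightarrow> y"
    if r: "\<And>k j. j < n \<Longrightarrow> q k j \<le> r k j \<and> r k j \<le> q k j + 1" for r
    unfolding tendsto_fun_iff
  proof
    fix i
    have base: "(\<lambda>k. G (\<rho> k) (q (\<rho> k)) i) \<longlonglongrightarrow> y i"
      using lim unfolding tendsto_fun_iff by (simp add: o_def)
    have "(\<lambda>k. inverse (real (Suc k))) \<longlonglongrightarrow> 0"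
      by (rule LIMSEQ_inverse_real_of_nat)
    then have "(\<lambda>k. inverse (real (Suc (\<rho> k)))) \<longlonglongrightarrow> 0"
      using \<rho> LIMSEQ_subseq_LIMSEQ[of "\<lambda>k. inverse (real (Suc k))" 0 \<rho>] by (simp add: o_def)
    from tendsto_add[OF base this]
    have up: "(\<lambda>k. G (\<rho> k) (q (\<rho> k)) i + inverse (real (Suc (\<rho> k)))) \<longlonglongrightarrow> y i"
      by simp
    have lo: "G k (q k) i \<le> G k (r k) i" for k
      using r by (auto simp: G_def divide_right_mono)
    have hi: "G k (r k) i \<le> G k (q k) i + inverse (real (Suc k))" for k
    proof (cases "i < n")
      case True
      then have "real (r k i) / real (Suc k) \<le> (real (q k i) + 1) / real (Suc k)"
        using r[of i k] by (intro divide_right_mono) auto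
      then show ?thesis
        using True by (simp add: G_def add_divide_distrib inverse_eq_divide)
    qed (simp add: G_def)
    show "(\<lambda>k. G (\<rho> k) (r (\<rho> k)) i) \<longlonglongrightarrow> y i"
      by (rule tendsto_sandwich[OF _ _ base up]) (intro always_eventually allI lo hi)+
  qed
  have cube: "G k t \<in> unit_cube n" if "\<forall>j<n. q k j \<le> t j \<and> t j \<le> q k j + 1" for k t
    using that q by (intro G_cube) (metis Suc_eq_plus1 Suc_leI le_trans)
  have f_lim: "(\<lambda>k. f (G (\<rho> k) (r (\<rho> k))) i) \<longlonglongrightarrow> f y i"
    if r: "\<And>k j. j < n \<Longrightarrow> q k j \<le> r k j \<and> r k j \<le> q k j + 1" for r i
  proof -
    have "G k (r k) \<in> unit_cube n" for k
      using r by (intro cube) blast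
    then have "(\<lambda>k. f (G (\<rho> k) (r (\<rho> k)))) \<longlonglongrightarrow> f y"
      using continuous_on_tendsto_compose[OF cont near[OF r] y] by simp
    then show ?thesis unfolding tendsto_fun_iff by blast
  qed
  have "f y i = y i" for i
  proof (cases "i < n")
    case False
    moreover have "f y \<in> unit_cube n" using y maps by blast
    ultimately show ?thesis using y by (auto simp: unit_cube_def dest!: spec[of _ i])
  next
    case True
    have "\<exists>r s. (\<forall>j<n. q k j \<le> r j \<and> r j \<le> q k j + 1) \<and> (\<forall>j<n. q k j \<le> s j \<and> s j \<le> q k j + 1) \<and>
      label (G k r) i = 0 \<and> label (G k s) i = 1" for k
    proof -
      obtain r s where rs: "\<forall>j<n. q k j \<le> r j \<and> r j \<le> q k j + 1"
        "\<forall>j<n. q k j \<le> s j \<and> s j \<le> q k j + 1" "label (G k r) i \<noteq> label (G k s) i"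
        using cell[OF True, of k] by blast
      have "label (G k r) i = 0 \<and> label (G k s) i = 1 \<or> label (G k r) i = 1 \<and> label (G k s) i = 0"
        using label(1)[of "G k r" i] label(1)[of "G k s" i] rs(3) by linarith
      then show ?thesis using rs by blast
    qed
    then have "\<forall>k. \<exists>rs. (\<forall>j<n. q k j \<le> fst rs j \<and> fst rs j \<le> q k j + 1) \<and>
      (\<forall>j<n. q k j \<le> snd rs j \<and> snd rs j \<le> q k j + 1) \<and>
      label (G k (fst rs)) i = 0 \<and> label (G k (snd rs)) i = 1" by (metis fst_conv snd_conv)
    from choice[OF this] obtain rs where
      rs: "\<forall>k. (\<forall>j<n. q k j \<le> fst (rs k) j \<and> fst (rs k) j \<le> q k j + 1) \<and>
      (\<forall>j<n. q k j \<le> snd (rs k) j \<and> snd (rs k) j \<le> q k j + 1) \<and>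
      label (G k (fst (rs k))) i = 0 \<and> label (G k (snd (rs k))) i = 1" by blast
    define r s where "r = (\<lambda>k. fst (rs k))" and "s = (\<lambda>k. snd (rs k))"
    have r: "\<And>k j. j < n \<Longrightarrow> q k j \<le> r k j \<and> r k j \<le> q k j + 1"
      and s: "\<And>k j. j < n \<Longrightarrow> q k j \<le> s k j \<and> s k j \<le> q k j + 1"
      and l: "\<And>k. label (G k (r k)) i = 0" "\<And>k. label (G k (s k)) i = 1"
      using rs unfolding r_def s_def by blast+
    have "y i \<le> f y i"
    proof (rule LIMSEQ_le)
      show "(\<lambda>k. G (\<rho> k) (r (\<rho> k)) i) \<longlonglongrightarrow> y i" using near[OF r] by (simp add: tendsto_fun_iff)
      show "(\<lambda>k. f (G (\<rho> k) (r (\<rho> k))) i) \<longlonglongrightarrow> f y i" by (rule f_lim[OF r])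
      show "\<exists>N. \<forall>k\<ge>N. G (\<rho> k) (r (\<rho> k)) i \<le> f (G (\<rho> k) (r (\<rho> k))) i"
        using label(4) cube r l(1) True by blast
    qed
    moreover have "f y i \<le> y i"
    proof (rule LIMSEQ_le)
      show "(\<lambda>k. G (\<rho> k) (s (\<rho> k)) i) \<longlonglongrightarrow> y i" using near[OF s] by (simp add: tendsto_fun_iff)
      show "(\<lambda>k. f (G (\<rho> k) (s (\<rho> k))) i) \<longlonglongrightarrow> f y i" by (rule f_lim[OF s])
      show "\<exists>N. \<forall>k\<ge>N. f (G (\<rho> k) (s (\<rho> k))) i \<le> G (\<rho> k) (s (\<rho> k)) i"
        using label(5) cube s l(2) True by blast
    qed
    ultimately show ?thesis by simp
  qed
  then show ?thesis using that y by blast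
qed

definition std_simplex :: "nat \<Rightarrow> (nat \<Rightarrow> real) set" where
  "std_simplex n = {x. (\<forall>i. 0 \<le> x i) \<and> (\<forall>i>n. x i = 0) \<and> (\<Sum>i\<le>n. x i) = 1}"

lemma std_simplex_subset_unit_cube: "std_simplex n \<subseteq> unit_cube (Suc n)"
proof
  fix x assume x: "x \<in> std_simplex n"
  have "x i \<le> 1" if "i \<le> n" for i
    using x that member_le_sum[of i "{..n}" x] by (simp add: std_simplex_def)
  then show "x \<in> unit_cube (Suc n)" using x by (auto simp: std_simplex_def unit_cube_def)
qed

lemma closed_std_simplex: "closed (std_simplex n)"
proof -
  have ev: "continuous_on UNIV (\<lambda>x::nat \<Rightarrow> real. x i)" for i by simp
  have "std_simplex n = (\<Inter>i. {x. 0 \<le> x i}) \<inter> (\<Inter>i\<in>{n<..}. {x. x i = 0}) \<inter> {x. (\<Sum>i\<le>n. x i) = 1}"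
    by (auto simp: std_simplex_def)
  also have "closed \<dots>"
    by (intro closed_Int closed_INT ballI closed_Collect_le closed_Collect_eq
        continuous_on_sum continuous_on_const ev)
  finally show ?thesis .
qed

text \<open>This dual form of the Knaster-Kuratowski-Mazurkiewicz lemma is what the main proof takes from
Brouwer's theorem. Let \<open>g\<close> map a point to its normalised distances from the complements of the
sets \<open>W i\<close>. A fixed point \<open>x\<close> of \<open>g\<close> has \<open>x i > 0\<close> only if it has positive distance to the
complement of \<open>W i\<close>. Brouwer's theorem holds on the cube, hence \<open>g\<close> is composed with a retraction
of the cube onto the simplex; fixed points of the composition lie in the simplex.\<close>

lemma std_simplex_open_cover:
  fixes W :: "nat \<Rightarrow> (nat \<Rightarrow> real) set"
  assumes opn: "\<And>i. i \<le> p \<Longrightarrow> openin (top_of_set (std_simplex p)) (W i)"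
    and cover: "std_simplex p \<subseteq> (\<Union>i\<le>p. W i)"
  obtains x where "x \<in> std_simplex p" "\<And>i. i \<le> p \<Longrightarrow> 0 < x i \<Longrightarrow> x \<in> W i"
proof -
  let ?S = "std_simplex p"
  \<comment> \<open>\<^term>\<open>infdist x {}\<close> is \<open>0\<close>, so a point outside the simplex keeps the distance positive
    when \<open>W i\<close> is the whole simplex.\<close>
  define far :: "nat \<Rightarrow> real" where "far = (\<lambda>_. 2)"
  have far: "far \<notin> ?S" by (auto simp: far_def std_simplex_def intro!: exI[of _ "Suc p"])
  define \<beta> where "\<beta> i x = infdist x (insert far (?S - W i))" for i x
  have \<beta>_nonneg: "0 \<le> \<beta> i x" for i x by (simp add: \<beta>_def infdist_nonneg)
  have \<beta>_pos: "0 < \<beta> i x \<longleftrightarrow> x \<in> W i" if "x \<in> ?S" "i \<le> p" for i x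
  proof -
    have "closed (?S - W i)"
      using closedin_closed_trans[OF _ closed_std_simplex] closedin_diff[OF closedin_subtopology_refl[THEN iffD2] opn[OF that(2)]]
      by simp
    then have "closed (insert far (?S - W i))" by (rule closed_insert)
    then have "\<beta> i x = 0 \<longleftrightarrow> x \<in> insert far (?S - W i)"
      unfolding \<beta>_def by (metis in_closed_iff_infdist_zero insert_not_empty)
    then show ?thesis using that far \<beta>_nonneg[of i x] by auto
  qed
  define s where "s x = (\<Sum>i\<le>p. x i)" for x :: "nat \<Rightarrow> real"
  \<comment> \<open>A retraction of the cube onto the simplex: mass missing from a total of \<open>1\<close> goes to
    coordinate \<open>0\<close>, excess mass is scaled away.\<close>
  define \<rho> :: "(nat \<Rightarrow> real) \<Rightarrow> nat \<Rightarrow> real" where "\<rho> x i = (if i \<le> p then (x i + (if i = 0 then max 0 (1 - s x) else 0)) / max 1 (s x) else 0)"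
    for x i
  have \<rho>_S: "\<rho> x \<in> ?S" if "x \<in> unit_cube (Suc p)" for x
  proof -
    have x: "0 \<le> x i" if "i \<le> p" for i
      using \<open>x \<in> unit_cube (Suc p)\<close> that by (auto simp: unit_cube_def dest!: spec[of _ i])
    have nonneg: "0 \<le> \<rho> x i" for i by (auto simp: \<rho>_def x)
    have "(\<Sum>i\<le>p. \<rho> x i) = (\<Sum>i\<le>p. x i + (if i = 0 then max 0 (1 - s x) else 0)) / max 1 (s x)"
      by (simp add: \<rho>_def sum_divide_distrib)
    also have "\<dots> = (s x + max 0 (1 - s x)) / max 1 (s x)"
      by (simp add: sum.distrib s_def)
    also have "\<dots> = 1" by (simp add: max_def)
    finally have sum: "(\<Sum>i\<le>p. \<rho> x i) = 1" .
    show ?thesis using nonneg sum by (auto simp: std_simplex_def \<rho>_def)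
  qed
  have \<rho>_id: "\<rho> x = x" if "x \<in> ?S" for x
    using that by (auto simp: std_simplex_def \<rho>_def s_def)
  have cont_s: "continuous_on A s" for A
    unfolding s_def by (intro continuous_intros continuous_on_product_then_coordinatewise continuous_on_id)
  have cont_\<rho>: "continuous_on A \<rho>" for A
  proof (rule continuous_on_coordinatewise_then_product)
    fix i :: nat
    have num: "continuous_on A (\<lambda>x. if i = 0 then max 0 (1 - s x) else 0)"
      by (cases "i = 0") (auto intro!: continuous_on_max continuous_on_diff continuous_on_const cont_s)
    have den: "continuous_on A (\<lambda>x. max 1 (s x))"
      by (intro continuous_on_max continuous_on_const cont_s)
    have "continuous_on A (\<lambda>x. (x i + (if i = 0 then max 0 (1 - s x) else 0)) / max 1 (s x))"
      by (intro continuous_on_divide continuous_on_add num den continuous_on_subset[OF continuous_on_product_coordinates subset_UNIV])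
        (auto simp: max_def)
    then show "continuous_on A (\<lambda>x. \<rho> x i)"
      by (cases "i \<le> p") (simp_all add: \<rho>_def)
  qed
  define t where "t x = (\<Sum>j\<le>p. \<beta> j x)" for x
  have t_pos: "0 < t x" if "x \<in> ?S" for x
  proof -
    obtain i where i: "i \<le> p" "x \<in> W i" using cover \<open>x \<in> ?S\<close> by blast
    then have "0 < \<beta> i x" using \<beta>_pos \<open>x \<in> ?S\<close> by blast
    then show ?thesis unfolding t_def using i by (intro sum_pos2[of _ i]) (auto simp: \<beta>_nonneg)
  qed
  define g where "g x i = (if i \<le> p then \<beta> i x / t x else 0)" for x i
  have g_S: "g x \<in> ?S" if "x \<in> ?S" for x
  proof -
    have "(\<Sum>i\<le>p. g x i) = 1"
      using t_pos[OF that] by (simp add: g_def t_def flip: sum_divide_distrib)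
    moreover have nonneg: "0 \<le> g x i" for i
      using t_pos[OF that] by (simp add: g_def \<beta>_nonneg)
    ultimately show ?thesis by (auto simp: std_simplex_def g_def)
  qed
  have cont_g: "continuous_on ?S g"
  proof (rule continuous_on_coordinatewise_then_product)
    fix i
    have "continuous_on ?S (\<lambda>x. \<beta> i x / t x)"
      unfolding t_def \<beta>_def
      by (intro continuous_intros) (use t_pos in \<open>force simp: t_def \<beta>_def\<close>)
    then show "continuous_on ?S (\<lambda>x. g x i)"
      by (cases "i \<le> p") (simp_all add: g_def)
  qed
  obtain x where x: "x \<in> unit_cube (Suc p)" "(g \<circ> \<rho>) x = x"
  proof (rule brouwer_unit_cube)
    show "continuous_on (unit_cube (Suc p)) (g \<circ> \<rho>)"
      by (intro continuous_on_compose cont_\<rho> continuous_on_subset[OF cont_g]) (use \<rho>_S in blast)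
    show "(g \<circ> \<rho>) ` unit_cube (Suc p) \<subseteq> unit_cube (Suc p)"
      using \<rho>_S g_S std_simplex_subset_unit_cube by fastforce
  qed
  have "x \<in> ?S" using x g_S[OF \<rho>_S[OF x(1)]] by simp
  then have gx: "g x = x" using x(2) \<rho>_id by simp
  show ?thesis
  proof
    show "x \<in> ?S" by fact
    fix i assume i: "i \<le> p" "0 < x i"
    then have "0 < \<beta> i x / t x" using gx by (metis g_def)
    then have "0 < \<beta> i x" using t_pos[OF \<open>x \<in> ?S\<close>] by (simp add: zero_less_divide_iff)
    then show "x \<in> W i" using \<beta>_pos[OF \<open>x \<in> ?S\<close> i(1)] by simp
  qed
qed

section \<open>The Gale-Debreu-Nikaido lemma\<close>

text \<open>Alaoglu's argument: as \<open>v\<close> is an order unit, the normalisation \<open>p v = -1\<close> bounds \<open>p x\<close>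
for every \<open>x\<close> independently of \<open>p\<close>, so the polar base is a closed subset of a product of compact
intervals.\<close>

lemma compact_polar_base:
  fixes C :: "'a::real_vector set"
  assumes unit: "\<And>x. \<exists>s>0. v + s *\<^sub>R x \<in> C"
  shows "compact (polar_base algebraic_dual C v)" (is "compact ?D")
proof -
  have D: "?D = {p. linear p} \<inter> (\<Inter>c\<in>C. {p. p c \<le> 0}) \<inter> {p. p v = -1}"
    by (auto simp: polar_base_def polar_cone_def algebraic_dual_def)
  have upper: "\<exists>M. \<forall>p\<in>?D. p x \<le> M" for x
  proof -
    obtain s where s: "0 < s" "v + s *\<^sub>R x \<in> C" using unit by blast
    have "p x \<le> 1 / s" if "p \<in> ?D" for p
    proof -
      have "p (v + s *\<^sub>R x) \<le> 0" "linear p" "p v = -1" using that s(2) unfolding D by auto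
      then have "s * p x \<le> 1" by (simp add: linear_add linear_scale)
      then show ?thesis using s(1) by (simp add: field_simps)
    qed
    then show ?thesis by blast
  qed
  have "\<exists>M. \<forall>p\<in>?D. p x \<in> {- M..M}" for x
  proof -
    obtain M M' where "\<forall>p\<in>?D. p x \<le> M" "\<forall>p\<in>?D. p (- x) \<le> M'"
      using upper[of x] upper[of "- x"] by blast
    moreover have "p (- x) = - p x" if "p \<in> ?D" for p
      using that unfolding D by (simp add: linear_neg)
    ultimately have "\<forall>p\<in>?D. p x \<in> {- max M M'..max M M'}" by fastforce
    then show ?thesis by blast
  qed
  then obtain M where M: "\<And>x p. p \<in> ?D \<Longrightarrow> p x \<in> {- M x..M x}" by metis
  let ?B = "{p. \<forall>x. p x \<in> {- M x..M x}}"
  have "compact ?B" by (rule compact_Pi_UNIV) simp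
  moreover have "closed ?D"
  proof -
    have ev: "continuous_on UNIV (\<lambda>p::'a \<Rightarrow> real. p x)" for x by simp
    have "{p::'a \<Rightarrow> real. linear p} =
        {p. \<forall>x y. p (x + y) = p x + p y} \<inter> {p. \<forall>r x. p (r *\<^sub>R x) = r * p x}"
      by (auto simp: linear_iff)
    moreover have "closed {p::'a \<Rightarrow> real. \<forall>x y. p (x + y) = p x + p y}"
      by (intro closed_Collect_all closed_Collect_eq continuous_on_add ev)
    moreover have "closed {p::'a \<Rightarrow> real. \<forall>r x. p (r *\<^sub>R x) = r * p x}"
      by (intro closed_Collect_all closed_Collect_eq continuous_on_mult continuous_on_const ev)
    moreover have "closed (\<Inter>c\<in>C. {p::'a \<Rightarrow> real. p c \<le> 0})"
      by (intro closed_INT ballI closed_Collect_le continuous_on_const ev)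
    moreover have "closed {p::'a \<Rightarrow> real. p v = -1}"
      by (intro closed_Collect_eq continuous_on_const ev)
    ultimately show ?thesis unfolding D by (intro closed_Int) auto
  qed
  ultimately have "compact (?B \<inter> ?D)" by (rule compact_Int_closed)
  moreover have "?B \<inter> ?D = ?D" using M by blast
  ultimately show ?thesis by simp
qed

theorem mainTheorem1:
  fixes P :: "('a::{real_topological_vector_space, t2_space} \<Rightarrow> real) set"
    and C :: "'a set"
    and v :: 'a
    and \<xi> :: "('a \<Rightarrow> real) \<Rightarrow> 'a set"
  assumes dual_separates: "separates_points (algebraic_dual :: ('a \<Rightarrow> real) set)"
    and P_subspace: "dual_subspace P"
    and P_total: "separates_points P"
    and P_closed: "closedin weak_star_topology P"
    and C_nonempty: "C \<noteq> {}"
    and C_proper: "C \<noteq> UNIV"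
    and C_closed: "closed C"
    and C_convex: "convex C"
    and C_cone: "cone C"
    and v_interior: "v \<in> interior C"
    and polar_nondegenerate: "polar_cone P C \<noteq> {\<lambda>x. 0}"
    and demicontinuous:
      "upper_demicontinuous
         (subtopology (subtopology weak_star_topology P) (polar_base P C v)) \<xi>"
    and values_nonempty: "\<And>p. p \<in> polar_base P C v \<Longrightarrow> \<xi> p \<noteq> {}"
    and values_compact: "\<And>p. p \<in> polar_base P C v \<Longrightarrow> compact (\<xi> p)"
    and values_convex: "\<And>p. p \<in> polar_base P C v \<Longrightarrow> convex (\<xi> p)"
    and weak_Walras: "\<And>p. p \<in> polar_base P C v \<Longrightarrow> \<exists>z\<in>\<xi> p. p z \<le> 0"
  shows "\<exists>p\<in>polar_base P C v. \<xi> p \<inter> C \<noteq> {}"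
proof (rule ccontr)
  assume contra: "\<not> ?thesis"
  define D where "D = polar_base P C v"
  have P: "P = algebraic_dual"
    by (rule total_weak_star_closed_eq_dual[OF P_subspace P_total P_closed])
  have D_iff: "p \<in> D \<longleftrightarrow> linear p \<and> (\<forall>c\<in>C. p c \<le> 0) \<and> p v = -1" for p
    by (auto simp: D_def P polar_base_def polar_cone_def algebraic_dual_def)
  have "compact D"
    unfolding D_def P by (rule compact_polar_base[OF interior_point_order_unit[OF v_interior]])
  have topD: "subtopology (subtopology weak_star_topology P) (polar_base P C v) = top_of_set D"
  proof -
    have "algebraic_dual \<inter> (algebraic_dual \<inter> D) = D"
      by (auto simp: D_iff algebraic_dual_def)
    then show ?thesis
      unfolding D_def[symmetric] unfolding weak_star_topology_eq P subtopology_subtopology by simp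
  qed
  \<comment> \<open>Separating the one-point set \<open>{- v}\<close> from \<open>C\<close> shows that the base is not empty.\<close>
  have "- v \<notin> C" by (rule uminus_interior_notin_cone[OF C_convex C_cone C_proper v_interior])
  then obtain q\<^sub>0 where "linear q\<^sub>0" "\<And>c. c \<in> C \<Longrightarrow> q\<^sub>0 c \<le> 0" "q\<^sub>0 v = (-1::real)"
    using compact_cone_separation[OF C_closed C_convex C_cone C_proper v_interior, of "{- v}"] by auto
  then have "D \<noteq> {}" using D_iff by blast

  define U where "U q = {p \<in> D. \<xi> p \<subseteq> {y. 0 < q y}}" for q :: "'a \<Rightarrow> real"
  have open_U: "openin (top_of_set D) (U q)" if "q \<in> D" for q
  proof -
    have q: "linear q" "\<And>c. c \<in> C \<Longrightarrow> q c \<le> 0" "q v = -1" using that D_iff by auto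
    have "continuous_on UNIV q" by (rule continuous_if_nonpos_near[OF q(1) v_interior q(2)])
    moreover have "q \<noteq> (\<lambda>x. 0)" using q(3) by auto
    ultimately have "open_half_space {y. 0 < q y}"
      unfolding open_half_space_def using q(1) by blast
    then show ?thesis
      using demicontinuous unfolding topD upper_demicontinuous_def U_def by auto
  qed
  have "\<exists>q\<in>D. p \<in> U q" if "p \<in> D" for p
  proof -
    have p: "p \<in> polar_base P C v" using that by (simp add: D_def)
    then have "\<xi> p \<inter> C = {}" using contra by blast
    then obtain q where "linear q" "\<And>c. c \<in> C \<Longrightarrow> q c \<le> 0" "q v = (-1::real)"
        "\<And>k. k \<in> \<xi> p \<Longrightarrow> 0 < q k"
      using compact_cone_separation[OF C_closed C_convex C_cone C_proper v_interior
          values_compact[OF p] values_convex[OF p] values_nonempty[OF p]] by blast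
    then show ?thesis using that D_iff by (intro bexI[of _ q]) (auto simp: U_def)
  qed
  then have "D \<subseteq> \<Union>(U ` D)" by blast
  then obtain F where "F \<subseteq> U ` D" "finite F" "D \<subseteq> \<Union>F"
    using \<open>compact D\<close> open_U unfolding compact_eq_openin_cover by (metis (no_types, lifting) imageE)
  then obtain Q where Q: "Q \<subseteq> D" "finite Q" "D \<subseteq> (\<Union>q\<in>Q. U q)"
    by (metis finite_subset_image)
  have "Q \<noteq> {}" using Q(3) \<open>D \<noteq> {}\<close> by blast
  then obtain n where n: "card Q = Suc n" using Q(2) by (metis card_gt_0_iff gr0_implies_Suc)
  obtain e where "bij_betw e {0..<card Q} Q" using ex_bij_betw_nat_finite[OF Q(2)] by blast
  then have e: "e ` {..n} = Q"
    by (simp add: n bij_betw_def atLeast0LessThan lessThan_Suc_atMost)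
  have eD: "e i \<in> D" if "i \<le> n" for i using that e Q(1) by blast

  let ?S = "std_simplex n"
  define comb where "comb x = (\<lambda>y. \<Sum>i\<le>n. x i * e i y)" for x :: "nat \<Rightarrow> real"
  have comb_D: "comb x \<in> D" if "x \<in> ?S" for x
  proof -
    have x: "\<And>i. 0 \<le> x i" "(\<Sum>i\<le>n. x i) = 1" using that by (auto simp: std_simplex_def)
    have e_lin: "\<And>i. i \<le> n \<Longrightarrow> linear (e i)" using eD D_iff by blast
    have "linear (comb x)"
      unfolding comb_def
      by (rule linearI)
        (simp_all add: e_lin linear_add linear_scale sum_distrib_left distrib_left
          mult.left_commute flip: sum.distrib)
    moreover have "comb x c \<le> 0" if "c \<in> C" for c
      unfolding comb_def using eD D_iff that x(1)
      by (intro sum_nonpos mult_nonneg_nonpos) auto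
    moreover have "comb x v = -1"
      using eD D_iff x(2) by (simp add: comb_def sum_negf)
    ultimately show ?thesis using D_iff by blast
  qed
  have cont_comb: "continuous_on ?S comb"
    unfolding comb_def
    by (intro continuous_on_coordinatewise_then_product continuous_on_sum continuous_on_mult
        continuous_on_const continuous_on_subset[OF continuous_on_product_coordinates subset_UNIV])
  have pull_open: "openin (top_of_set ?S) (?S \<inter> comb -` U (e i))" if "i \<le> n" for i
    by (rule continuous_openin_preimage[OF cont_comb _ open_U[OF eD[OF that]]])
      (use comb_D in blast)
  have pull_cover: "?S \<subseteq> (\<Union>i\<le>n. ?S \<inter> comb -` U (e i))"
  proof
    fix x assume x: "x \<in> ?S"
    then obtain q where "q \<in> Q" and q: "comb x \<in> U q" using comb_D Q(3) by blast
    then obtain i where "i \<le> n" "q = e i" using e by (metis atMost_iff imageE)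
    then show "x \<in> (\<Union>i\<le>n. ?S \<inter> comb -` U (e i))" using x q by auto
  qed
  obtain x where x: "x \<in> ?S" and
    hit: "\<And>i. i \<le> n \<Longrightarrow> 0 < x i \<Longrightarrow> x \<in> ?S \<inter> comb -` U (e i)"
    using std_simplex_open_cover[OF pull_open pull_cover] by blast
  \<comment> \<open>Every \<open>e i\<close> that enters the combination with a positive weight is positive on the whole
    value at the combination, contrary to Walras' law.\<close>
  obtain z where z: "z \<in> \<xi> (comb x)" "comb x z \<le> 0"
    using weak_Walras comb_D[OF x] unfolding D_def by blast
  have x_nonneg: "\<And>i. 0 \<le> x i" and x_sum: "(\<Sum>i\<le>n. x i) = 1"
    using x by (auto simp: std_simplex_def)
  have pos: "0 < e i z" if "i \<le> n" "0 < x i" for i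
    using hit[OF that] z(1) by (auto simp: U_def)
  have "\<exists>i\<le>n. 0 < x i"
    using x_sum x_nonneg by (metis atMost_iff less_eq_real_def sum.neutral zero_neq_one)
  then obtain i where i: "i \<le> n" "0 < x i" by blast
  have "0 < comb x z"
    unfolding comb_def
  proof (rule sum_pos2[of _ i])
    show "0 \<le> x j * e j z" if "j \<in> {..n}" for j
      using pos[of j] x_nonneg[of j] that by (cases "x j = 0") auto
  qed (use i pos in auto)
  then show False using z(2) by simp
qed

end
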